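(* Let $(X,d)$ be a (nonempty) compact metric space and $\alpha:X\to X$ a continuous map that is a non-contracting local homeomorphism on $X_\alpha$ (i.e. the restriction $\alpha:X_\alpha\to X_\alpha$ is a non-contracting local homeomorphism). Then $\alpha$ possesses Property $( ** )$: for each $\varepsilon>0$ there exists a finite set $F(\varepsilon)\subset X_\alpha$ such that for each $n\in\mathbb N$ the set $\alpha^{-n}(F(\varepsilon))\cap X_\alpha$ is $(n,\varepsilon)$-spanning for $X_\alpha$.
   Context: $M_\alpha(X)$ is the set of Borel $\alpha$-invariant probability measures on $X$. A point $x\in X$ is essential if every neighborhood $V$ of $x$ satisfies $\mu(V)>0$ for some $\mu\in M_\alpha(X)$; $X_\alpha$ is the (closed) set of essential points, and $\alpha(X_\alpha)=X_\alpha$. A local homeomorphism is a map such that every point has an open neighborhood mapped homeomorphically onto an open set. A map $\alpha$ of a metric space into itself is non-contracting if there is $r>0$ such that $d(x,y)\le r$ implies $d(\alpha(x),\alpha(y))\ge d(x,y)$. Put $d_n(x,y):=\max_{0\le i\le n-1}d(\alpha^i(x),\alpha^i(y))$. A set $E\subset X_\alpha$ is $(n,\varepsilon)$-spanning for $X_\alpha$ if for every $x\in X_\alpha$ there is $y\in E$ with $d_n(x,y)<\varepsilon$. *)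

theory Defs
  imports "HOL-Analysis.Analysis" "HOL-Probability.Probability_Measure"
begin

text \<open>A compact metric space is a compact set \<open>X\<close> in a type of class \<open>metric_space\<close>; a self-map of
  \<open>X\<close> is a total function mapping \<open>X\<close> into \<open>X\<close>. Its values outside \<open>X\<close> play no role.\<close>

definition invariant_measures :: "'a::metric_space set \<Rightarrow> ('a \<Rightarrow> 'a) \<Rightarrow> 'a measure set" where
  "invariant_measures X \<alpha> =
     {\<mu>. prob_space \<mu> \<and> sets \<mu> = sets (restrict_space borel X) \<and>
         \<alpha> \<in> measurable \<mu> \<mu> \<and> distr \<mu> \<mu> \<alpha> = \<mu>}"

text \<open>It suffices to test relatively open neighbourhoods, which are Borel in \<open>X\<close>.\<close>

definition essential_points :: "'a::metric_space set \<Rightarrow> ('a \<Rightarrow> 'a) \<Rightarrow> 'a set" where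
  "essential_points X \<alpha> =
     {x \<in> X. \<forall>V. openin (top_of_set X) V \<and> x \<in> V \<longrightarrow>
               (\<exists>\<mu> \<in> invariant_measures X \<alpha>. measure \<mu> V > 0)}"

definition local_homeomorphism_on :: "'a::topological_space set \<Rightarrow> ('a \<Rightarrow> 'a) \<Rightarrow> bool" where
  "local_homeomorphism_on S \<alpha> \<longleftrightarrow>
     (\<forall>x \<in> S. \<exists>U V \<beta>. openin (top_of_set S) U \<and> x \<in> U \<and>
        openin (top_of_set S) V \<and> homeomorphism U V \<alpha> \<beta>)"

definition non_contracting_on :: "'a::metric_space set \<Rightarrow> ('a \<Rightarrow> 'a) \<Rightarrow> bool" where
  "non_contracting_on S \<alpha> \<longleftrightarrow>
     (\<exists>r > 0. \<forall>x \<in> S. \<forall>y \<in> S. dist x y \<le> r \<longrightarrow> dist (\<alpha> x) (\<alpha> y) \<ge> dist x y)"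

text \<open>Only meaningful for \<open>n \<ge> 1\<close>, since \<open>Max {}\<close> is unspecified.\<close>

definition dist_n :: "('a::metric_space \<Rightarrow> 'a) \<Rightarrow> nat \<Rightarrow> 'a \<Rightarrow> 'a \<Rightarrow> real" where
  "dist_n \<alpha> n x y = Max ((\<lambda>i. dist ((\<alpha> ^^ i) x) ((\<alpha> ^^ i) y)) ` {0..<n})"

definition spanning :: "('a::metric_space \<Rightarrow> 'a) \<Rightarrow> 'a set \<Rightarrow> nat \<Rightarrow> real \<Rightarrow> 'a set \<Rightarrow> bool" where
  "spanning \<alpha> S n \<epsilon> E \<longleftrightarrow> E \<subseteq> S \<and> (\<forall>x \<in> S. \<exists>y \<in> E. dist_n \<alpha> n x y < \<epsilon>)"

definition property_star_star :: "'a::metric_space set \<Rightarrow> ('a \<Rightarrow> 'a) \<Rightarrow> bool" where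
  "property_star_star X \<alpha> \<longleftrightarrow>
     (\<forall>\<epsilon> > 0. \<exists>F. finite F \<and> F \<subseteq> essential_points X \<alpha> \<and>
        (\<forall>n \<ge> 1. spanning \<alpha> (essential_points X \<alpha>) n \<epsilon>
                    ((\<alpha> ^^ n) -` F \<inter> essential_points X \<alpha>)))"

end

theory Submission
  imports Defs
begin

text \<open>By compactness, the local inverses of \<open>\<alpha>\<close> on the compact set of essential points are defined on
  balls of a uniform radius \<open>\<delta>\<close>, and non-contraction makes them 1-Lipschitz at the centre. Hence a
  point \<open>z\<close> with \<open>dist ((\<alpha> ^^ n) x) z < \<delta>\<close> can be pulled back \<open>n\<close> times along the orbit of \<open>x\<close>
  without increasing the distance, so a finite \<open>min \<epsilon> \<delta>\<close>-net serves as \<open>F \<epsilon>\<close>.\<close>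

text \<open>A neighbourhood that is null for every invariant measure witnesses inessentiality of
  each of its points, so the complement in \<open>X\<close> is relatively open.\<close>

lemma compact_essential_points:
  fixes X :: "'a::metric_space set"
  assumes "compact X"
  shows "compact (essential_points X \<alpha>)"
proof -
  have "openin (top_of_set X) (X - essential_points X \<alpha>)"
  proof (subst openin_subopen, intro ballI)
    fix x assume "x \<in> X - essential_points X \<alpha>"
    then obtain V where V: "openin (top_of_set X) V" "x \<in> V"
      "\<not> (\<exists>\<mu> \<in> invariant_measures X \<alpha>. measure \<mu> V > 0)"
      unfolding essential_points_def by blast
    then have "V \<subseteq> X - essential_points X \<alpha>"
      using openin_imp_subset[OF V(1)] unfolding essential_points_def by blast
    with V show "\<exists>T. openin (top_of_set X) T \<and> x \<in> T \<and> T \<subseteq> X - essential_points X \<alpha>"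
      by blast
  qed
  moreover have "essential_points X \<alpha> \<subseteq> X"
    unfolding essential_points_def by blast
  ultimately have "closedin (top_of_set X) (essential_points X \<alpha>)"
    by (simp add: closedin_def)
  then show ?thesis
    using assms closedin_compact by blast
qed

text \<open>The target of every local chart is open in \<open>S\<close>, hence contained in
  \<open>S\<close>. Invariance of the essential points thus follows without any argument about
  measures.\<close>

lemma local_homeomorphism_on_image_subset:
  assumes "local_homeomorphism_on S f"
  shows "f ` S \<subseteq> S"
proof (intro image_subsetI)
  fix x assume "x \<in> S"
  then obtain U V g where "x \<in> U" "openin (top_of_set S) V" "homeomorphism U V f g"
    using assms unfolding local_homeomorphism_on_def by blast
  then show "f x \<in> S"
    using homeomorphism_image1 openin_imp_subset by blast
qed

text \<open>The local inverse \<open>g\<close> at \<open>x\<close> is continuous at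
  \<open>f x\<close>, so \<open>g z\<close> is a preimage of \<open>z\<close> close to
  \<open>x\<close>, hence also close to every \<open>x'\<close> near \<open>x\<close>. One radius
  \<open>e\<close> for all of \<open>W\<close> is what a covering argument can use.\<close>

lemma local_homeomorphism_on_locally_uniformly_open:
  fixes f :: "'a::metric_space \<Rightarrow> 'a"
  assumes "continuous_on S f" "local_homeomorphism_on S f" "r > 0" "x \<in> S"
  obtains e W where "e > 0" "open W" "x \<in> W"
    "\<And>x' z. \<lbrakk>x' \<in> W; x' \<in> S; z \<in> S; dist (f x') z < e\<rbrakk> \<Longrightarrow> \<exists>y\<in>S. f y = z \<and> dist x' y < r"
proof -
  obtain U V g where U: "openin (top_of_set S) U" "x \<in> U"
    and V: "openin (top_of_set S) V" and h: "homeomorphism U V f g"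
    using assms(2,4) unfolding local_homeomorphism_on_def by blast
  have fxV: "f x \<in> V"
    using h U homeomorphism_image1 by blast
  have gfx: "g (f x) = x"
    using h U homeomorphism_apply1 by blast
  obtain a where a: "a > 0" "\<And>z. \<lbrakk>z \<in> S; dist z (f x) < a\<rbrakk> \<Longrightarrow> z \<in> V"
    using V fxV unfolding openin_euclidean_subtopology_iff by meson
  obtain b where b: "b > 0" "\<And>z. \<lbrakk>z \<in> V; dist z (f x) < b\<rbrakk> \<Longrightarrow> dist (g z) x < r / 2"
    using homeomorphism_cont2[OF h] fxV \<open>r > 0\<close> gfx
    unfolding continuous_on_iff by (metis half_gt_zero)
  \<comment> \<open>Halved because the path from \<open>z\<close> to \<open>f x\<close> runs through
    \<open>f x'\<close>, and each leg is shorter than \<open>e\<close>.\<close>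
  define e where "e = min a b / 2"
  have "e > 0"
    using a b by (simp add: e_def)
  then obtain c where c: "c > 0" "\<And>x'. \<lbrakk>x' \<in> S; dist x' x < c\<rbrakk> \<Longrightarrow> dist (f x') (f x) < e"
    using assms(1,4) unfolding continuous_on_iff by meson
  show thesis
  \<comment> \<open>The radius \<open>c\<close> keeps \<open>f x'\<close> near \<open>f x\<close>,
    while \<open>r / 2\<close> leaves room for the other half of \<open>r\<close>, from
    \<open>x\<close> to the preimage.\<close>
  proof (rule that)
    show "e > 0" "open (ball x (min c (r / 2)))" "x \<in> ball x (min c (r / 2))"
      using \<open>e > 0\<close> c(1) \<open>r > 0\<close> by auto
    fix x' z
    assume x': "x' \<in> ball x (min c (r / 2))" "x' \<in> S" and z: "z \<in> S" "dist (f x') z < e"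
    have "dist (f x') (f x) < e"
      using c(2)[of x'] x' by (simp add: dist_commute[of x' x])
    then have "dist z (f x) < min a b"
      using z(2) dist_triangle3[of z "f x" "f x'"] by (simp add: e_def)
    then have "z \<in> V" and "dist (g z) x < r / 2"
      using a(2) b(2) z(1) by auto
    moreover have "dist x' y < r" if "dist y x < r / 2" for y
      using x'(1) that dist_triangle2[of x' y x] by (simp add: dist_commute)
    ultimately have "f (g z) = z" "g z \<in> S" "dist x' (g z) < r"
      using h homeomorphism_apply2 homeomorphism_image2 openin_imp_subset[OF U(1)]
      by blast+
    then show "\<exists>y\<in>S. f y = z \<and> dist x' y < r"
      by blast
  qed
qed

text \<open>Finitely many neighbourhoods \<open>W\<close> cover the compact set \<open>S\<close>,
  and the least of their radii works everywhere.\<close>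

lemma local_homeomorphism_on_uniformly_open:
  fixes f :: "'a::metric_space \<Rightarrow> 'a"
  assumes "compact S" "continuous_on S f" "local_homeomorphism_on S f" "r > 0"
  obtains \<delta> where "\<delta> > 0"
    "\<And>x z. \<lbrakk>x \<in> S; z \<in> S; dist (f x) z < \<delta>\<rbrakk> \<Longrightarrow> \<exists>y\<in>S. f y = z \<and> dist x y < r"
proof -
  define P where "P e W \<longleftrightarrow>
    (\<forall>x\<in>W \<inter> S. \<forall>z\<in>S. dist (f x) z < e \<longrightarrow> (\<exists>y\<in>S. f y = z \<and> dist x y < r))" for e W
  have "\<forall>x\<in>S. \<exists>e W. e > 0 \<and> open W \<and> x \<in> W \<and> P e W"
  proof
    fix x assume "x \<in> S"
    then show "\<exists>e W. e > 0 \<and> open W \<and> x \<in> W \<and> P e W"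
      by (rule local_homeomorphism_on_locally_uniformly_open[OF assms(2-4)])
        (unfold P_def, blast)
  qed
  then obtain e W where eW: "\<And>x. x \<in> S \<Longrightarrow> e x > 0 \<and> open (W x) \<and> x \<in> W x \<and> P (e x) (W x)"
    by metis
  obtain C where C: "C \<subseteq> S" "finite C" "S \<subseteq> (\<Union>x\<in>C. W x)"
    by (rule compactE_image[OF assms(1), of S W]) (use eW in blast)+
  show thesis
  proof (rule that)
    \<comment> \<open>The inserted 1 keeps \<open>Min\<close> meaningful when \<open>C\<close> is
      empty.\<close>
    show "Min (insert 1 (e ` C)) > 0"
      using C eW by (subst Min_gr_iff) auto
    fix x z assume "x \<in> S" "z \<in> S" "dist (f x) z < Min (insert 1 (e ` C))"
    moreover obtain c where "c \<in> C" "x \<in> W c"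
      using C \<open>x \<in> S\<close> by blast
    moreover have "Min (insert 1 (e ` C)) \<le> e c"
      using C \<open>c \<in> C\<close> by simp
    ultimately show "\<exists>y\<in>S. f y = z \<and> dist x y < r"
      using eW C(1) unfolding P_def by (meson IntI less_le_trans subsetD)
  qed
qed

text \<open>Lift the orbit of \<open>f x\<close> first, then take one more preimage. Bounding all
  distances by the terminal one keeps them below \<delta>, so that \<open>lift\<close> stays
  applicable.\<close>

lemma orbit_lift:
  fixes f :: "'a::metric_space \<Rightarrow> 'a"
  assumes "f ` S \<subseteq> S"
    and lift: "\<And>x z. \<lbrakk>x \<in> S; z \<in> S; dist (f x) z < \<delta>\<rbrakk> \<Longrightarrow> \<exists>y\<in>S. f y = z \<and> dist x y \<le> dist (f x) z"
    and "x \<in> S" "z \<in> S" "dist ((f ^^ n) x) z < \<delta>"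
  shows "\<exists>y\<in>S. (f ^^ n) y = z \<and> (\<forall>i\<le>n. dist ((f ^^ i) x) ((f ^^ i) y) \<le> dist ((f ^^ n) x) z)"
  using assms(3-)
proof (induction n arbitrary: x)
  case 0
  then show ?case by auto
next
  case (Suc n)
  have "f x \<in> S"
    using assms(1) Suc.prems by blast
  with Suc obtain y where y: "y \<in> S" "(f ^^ n) y = z"
    "\<And>i. i \<le> n \<Longrightarrow> dist ((f ^^ i) (f x)) ((f ^^ i) y) \<le> dist ((f ^^ Suc n) x) z"
    unfolding funpow_Suc_right comp_apply by metis
  have "dist (f x) y \<le> dist ((f ^^ Suc n) x) z"
    using y(3)[of 0] by simp
  moreover obtain w where w: "w \<in> S" "f w = y" "dist x w \<le> dist (f x) y"
    using lift[OF Suc.prems(1) y(1)] Suc.prems(3) calculation by auto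
  \<comment> \<open>Index 0 is the new lift; a positive index \<open>i\<close> is index
    \<open>i - 1\<close> on the orbits of \<open>f x\<close> and \<open>y\<close>.\<close>
  ultimately have "dist ((f ^^ i) x) ((f ^^ i) w) \<le> dist ((f ^^ Suc n) x) z" if "i \<le> Suc n" for i
    using that y(3)[of "i - 1"] by (cases i) (auto simp: funpow_swap1)
  moreover have "(f ^^ Suc n) w = z"
    using w y by (simp add: funpow_swap1)
  ultimately show ?case
    using w(1) by blast
qed

theorem lemma14:
  fixes X :: "'a::metric_space set" and \<alpha> :: "'a \<Rightarrow> 'a"
  assumes "compact X" and "X \<noteq> {}"
    and "continuous_on X \<alpha>" and "\<alpha> ` X \<subseteq> X"
    and "non_contracting_on (essential_points X \<alpha>) \<alpha>"
    and "local_homeomorphism_on (essential_points X \<alpha>) \<alpha>"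
  shows "property_star_star X \<alpha>"
proof -
  define S where "S = essential_points X \<alpha>"
  have S: "compact S" "local_homeomorphism_on S \<alpha>" "non_contracting_on S \<alpha>"
    using assms compact_essential_points by (auto simp: S_def)
  have "S \<subseteq> X"
    unfolding S_def essential_points_def by blast
  then have cont: "continuous_on S \<alpha>"
    using assms(3) continuous_on_subset by blast
  have inv: "\<alpha> ` S \<subseteq> S"
    using S(2) by (rule local_homeomorphism_on_image_subset)
  obtain r where "r > 0"
    and r: "\<And>x y. \<lbrakk>x \<in> S; y \<in> S; dist x y \<le> r\<rbrakk> \<Longrightarrow> dist x y \<le> dist (\<alpha> x) (\<alpha> y)"
    using S(3) unfolding non_contracting_on_def by blast
  obtain \<delta> where "\<delta> > 0" and
    \<delta>: "\<And>x z. \<lbrakk>x \<in> S; z \<in> S; dist (\<alpha> x) z < \<delta>\<rbrakk> \<Longrightarrow> \<exists>y\<in>S. \<alpha> y = z \<and> dist x y < r"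
    using local_homeomorphism_on_uniformly_open[OF S(1) cont S(2) \<open>r > 0\<close>] by metis
  \<comment> \<open>The preimage lies within \<open>r\<close> of \<open>x\<close>, exactly the range
    in which non-contraction compares \<open>dist x y\<close> with the distance of the
    images.\<close>
  have lift: "\<exists>y\<in>S. \<alpha> y = z \<and> dist x y \<le> dist (\<alpha> x) z"
    if "x \<in> S" "z \<in> S" "dist (\<alpha> x) z < \<delta>" for x z
    using \<delta>[OF that] r \<open>x \<in> S\<close> by fastforce
  have iter: "(\<alpha> ^^ n) x \<in> S" if "x \<in> S" for n x
    using inv that by (induction n) auto
  show ?thesis
    unfolding property_star_star_def S_def[symmetric]
  proof (intro allI impI)
    fix \<epsilon> :: real assume "\<epsilon> > 0"
    with \<open>\<delta> > 0\<close> have "min \<epsilon> \<delta> > 0"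
      by simp
    obtain F where F: "finite F" "F \<subseteq> S" "S \<subseteq> (\<Union>z\<in>F. ball z (min \<epsilon> \<delta>))"
      by (rule compactE_image[OF S(1), of S "\<lambda>z. ball z (min \<epsilon> \<delta>)"])
        (use \<open>min \<epsilon> \<delta> > 0\<close> in force)+
    have "spanning \<alpha> S n \<epsilon> ((\<alpha> ^^ n) -` F \<inter> S)" if "n \<ge> 1" for n
      unfolding spanning_def
    proof (intro conjI ballI)
      fix x assume "x \<in> S"
      then obtain z where z: "z \<in> F" "dist ((\<alpha> ^^ n) x) z < min \<epsilon> \<delta>"
        using F(3) iter[of x n] by (auto simp: dist_commute)
      have "\<exists>y\<in>S. (\<alpha> ^^ n) y = z \<and> (\<forall>i\<le>n. dist ((\<alpha> ^^ i) x) ((\<alpha> ^^ i) y) \<le> dist ((\<alpha> ^^ n) x) z)"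
        by (rule orbit_lift[where \<delta> = \<delta>]) (use inv lift \<open>x \<in> S\<close> F(2) z in auto)
      then obtain y where y: "y \<in> S" "(\<alpha> ^^ n) y = z"
        "\<And>i. i \<le> n \<Longrightarrow> dist ((\<alpha> ^^ i) x) ((\<alpha> ^^ i) y) \<le> dist ((\<alpha> ^^ n) x) z"
        by blast
      have "dist ((\<alpha> ^^ i) x) ((\<alpha> ^^ i) y) < \<epsilon>" if "i < n" for i
        using y(3)[of i] z(2) that by simp
      \<comment> \<open>\<open>n \<ge> 1\<close> makes the set under \<open>Max\<close> nonempty, as
        \<open>Max_less_iff\<close> requires.\<close>
      then have "dist_n \<alpha> n x y < \<epsilon>"
        unfolding dist_n_def using \<open>n \<ge> 1\<close> by (subst Max_less_iff) auto
      with y z show "\<exists>y\<in>(\<alpha> ^^ n) -` F \<inter> S. dist_n \<alpha> n x y < \<epsilon>"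
        by blast
    qed simp
    with F show "\<exists>F. finite F \<and> F \<subseteq> S \<and> (\<forall>n\<ge>1. spanning \<alpha> S n \<epsilon> ((\<alpha> ^^ n) -` F \<inter> S))"
      by blast
  qed
qed

end
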